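(* Let $G_0=\mathbb{I}\oplus\mathbb{I}\ell$ and let $$G_{0,\mathbb{Z}}^\#=\{x\in\mathbb{O}(K):\mathrm{Tr}_{K/\mathbb{Q}}B(x,g)\in\mathbb{Z}\ \text{for all } g\in G_0\}$$ be its trace-polar $\mathbb{Z}$-dual. Then the quotient $G_{0,\mathbb{Z}}^\#/G_0\simeq(\mathbb{Z}/5\mathbb{Z})^8$ contains no nonzero $\mathbb{F}_5$-subspace $C$ that is both trace-integral and octonion-stable. Equivalently, the first $\sqrt5$-denominator discriminant tower over $G_0$ contains no G3-B' candidate: no $\mathbb{Z}[\varphi]$-module $G$ with $G_0\subsetneq G\subseteq G_{0,\mathbb{Z}}^\#$ is a trace-integral golden octonion (G3-B') candidate.
   Context: Let $\varphi=(1+\sqrt5)/2$, $K=\mathbb{Q}(\sqrt5)$, and $\mathrm{Tr}_{K/\mathbb{Q}}$ the field trace. $\mathbb{H}(K)$ is the quaternion algebra over $K$ with basis $1,i,j,k$, $i^2=j^2=k^2=ijk=-1$, standard conjugation. The icosian ring $\mathbb{I}\subset\mathbb{H}(K)$ is the free $\mathbb{Z}[\varphi]$-module with basis $$e_1=1,\quad e_2=i,\quad e_3=\tfrac12(1+i+j+k),\quad e_4=\tfrac12(-1+(\varphi-1)i-\varphi j).$$ $\mathbb{O}(K)=\mathbb{H}(K)\oplus\mathbb{H}(K)\ell$ is the Cayley--Dickson double with product $(a+b\ell)(c+d\ell)=(ac-\overline{d}b)+(da+b\overline{c})\ell$, conjugation $\overline{a+b\ell}=\overline{a}-b\ell$,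 and norm $N(x)=x\overline{x}$. The polar form is $B(x,y)=N(x+y)-N(x)-N(y)$. For a subspace $C\subset G_{0,\mathbb{Z}}^\#/G_0$ let $G_C\subset G_{0,\mathbb{Z}}^\#$ be its preimage. $C$ is trace-integral if it is totally isotropic for the quadratic form induced by $x\mapsto\mathrm{Tr}_{K/\mathbb{Q}}N(x)\bmod\mathbb{Z}$, i.e. $\mathrm{Tr}_{K/\mathbb{Q}}N(x)\in\mathbb{Z}$ for all $x\in G_C$. $C$ is octonion-stable if it is stable under the maps induced by octonion conjugation and by left and right multiplication by elements of $G_0$. A trace-integral golden octonion (G3-B') candidate is a $\mathbb{Z}[\varphi]$-module $G\subset\mathbb{O}(K)$ such that: (1) $\mathrm{Tr}_{K/\mathbb{Q}}N(x)\in\mathbb{Z}$ for all $x\in G$; (2) $\mathrm{Tr}_{K/\mathbb{Q}}B(x,y)\in\mathbb{Z}$ for all $x,y\in G$; (3) $G$ is closed under octonion multiplication and conjugation; (4) $G$ has a finite distinguished norm-trace shell $S$ (a finite set of elements of $G$ with a fixed value of $\mathrm{Tr}_{K/\mathbb{Q}}N$); (5) $S$ is invariant under the reflections $v\mapsto v-\frac{2\langle v,\alpha\rangle}{\langle\alpha,\alpha\rangle}\alpha$, $\alpha\in S$ (with $\langle x,y\rangle=\mathrm{Re}(x\overline{y})$ on $\mathbb{O}(K)\otimes_K\mathbb{R}$), and is shell-indecomposable, meaning there is no orthogonal splitting $\mathbb{O}(K)\otimes_K\mathbb{R}=V_1\perp V_2$ with both $V_i$ nonzero and of the form $W_i\otimes_K\mathbb{R}$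 for $K$-subspaces $W_i\subset\mathbb{O}(K)$ such that $S=(S\cap V_1)\cup(S\cap V_2)$. *)

theory Defs
  imports
    Complex_Main
    "HOL-Algebra.Module"
    "HOL-Algebra.Product_Groups"
    "HOL-Number_Theory.Residues"
begin

section \<open>The field \<open>K = \<rat>(\<surd>5)\<close>\<close>

text \<open>\<open>Q5 a b\<close> stands for \<open>a + b\<surd>5\<close>.\<close>

datatype qsqrt5 = Q5 (rat_coeff: rat) (root_coeff: rat)

lemma rat_square_neq_5: "(x::rat) ^ 2 \<noteq> 5"
proof
  assume x: "x ^ 2 = 5"
  obtain a b where ab: "quotient_of x = (a, b)"
    by (cases "quotient_of x")
  have b: "b > 0" and cop: "coprime a b" and xab: "x = of_int a / of_int b"
    using quotient_of_denom_pos[OF ab] quotient_of_coprime[OF ab] quotient_of_div[OF ab] by auto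
  have "(of_int (a ^ 2) :: rat) = of_int (5 * b ^ 2)"
    using x b by (simp add: xab power_divide field_simps)
  then have eq: "a ^ 2 = 5 * b ^ 2"
    by (simp only: of_int_eq_iff)
  have "prime (5::int)"
    by simp
  moreover have "5 dvd a ^ 2"
    using eq by simp
  ultimately have da: "5 dvd a"
    using prime_dvd_power by blast
  then obtain c where "a = 5 * c" ..
  with eq have "b ^ 2 = 5 * c ^ 2"
    by (simp add: power_mult_distrib)
  then have "5 dvd b ^ 2"
    by simp
  with \<open>prime (5::int)\<close> have "5 dvd b"
    using prime_dvd_power by blast
  with da cop show False
    using coprime_common_divisor[of a b 5] by auto
qed

lemma qsqrt5_norm_eq_0: "(a::rat) ^ 2 - 5 * b ^ 2 = 0 \<Longrightarrow> a = 0 \<and> b = 0"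
proof (cases "b = 0")
  case False
  assume "a ^ 2 - 5 * b ^ 2 = 0"
  with False have "(a / b) ^ 2 = 5"
    by (simp add: field_simps)
  then show ?thesis
    using rat_square_neq_5 by blast
qed simp

instantiation qsqrt5 :: field
begin

definition "0 = Q5 0 0"
definition "1 = Q5 1 0"
definition "x + y = Q5 (rat_coeff x + rat_coeff y) (root_coeff x + root_coeff y)"
definition "- x = Q5 (- rat_coeff x) (- root_coeff x)"
definition "x - y = Q5 (rat_coeff x - rat_coeff y) (root_coeff x - root_coeff y)"
definition "x * y = Q5 (rat_coeff x * rat_coeff y + 5 * (root_coeff x * root_coeff y))
                       (rat_coeff x * root_coeff y + root_coeff x * rat_coeff y)"
definition "inverse x =
  (let n = rat_coeff x ^ 2 - 5 * root_coeff x ^ 2 in Q5 (rat_coeff x / n) (- root_coeff x / n))"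
definition "x div y = x * inverse y" for x y :: qsqrt5

instance
proof
  fix x :: qsqrt5
  assume "x \<noteq> 0"
  then have n: "rat_coeff x ^ 2 - 5 * root_coeff x ^ 2 \<noteq> 0"
    using qsqrt5_norm_eq_0[of "rat_coeff x" "root_coeff x"]
    by (cases x) (auto simp: zero_qsqrt5_def)
  then show "inverse x * x = 1"
    by (simp add: inverse_qsqrt5_def times_qsqrt5_def one_qsqrt5_def Let_def
        diff_divide_distrib[symmetric] power2_eq_square mult.commute)
qed (auto simp: zero_qsqrt5_def one_qsqrt5_def plus_qsqrt5_def uminus_qsqrt5_def
      minus_qsqrt5_def times_qsqrt5_def divide_qsqrt5_def inverse_qsqrt5_def algebra_simps
      intro!: qsqrt5.expand)

end

definition golden :: qsqrt5  (\<open>\<phi>\<close>)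
  where "\<phi> = Q5 (1/2) (1/2)"

text \<open>\<open>\<int>[\<phi>]\<close>; since \<open>\<phi>\<^sup>2 = \<phi> + 1\<close> it is spanned over \<open>\<int>\<close> by \<open>1\<close> and \<open>\<phi>\<close>.\<close>

definition Z_phi :: "qsqrt5 set"
  where "Z_phi = {of_int a + of_int b * \<phi> | a b. True}"

text \<open>The field trace of \<open>x\<close>, as the trace of the \<open>\<rat>\<close>-linear map \<open>y \<mapsto> x y\<close> in the basis \<open>1, \<surd>5\<close>.\<close>

definition K_trace :: "qsqrt5 \<Rightarrow> rat"
  where "K_trace x = rat_coeff (x * Q5 1 0) + root_coeff (x * Q5 0 1)"

lemma K_trace_Q5: "K_trace (Q5 a b) = 2 * a"
  by (simp add: K_trace_def times_qsqrt5_def)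

text \<open>The real embedding used in \<open>\<O>(K) \<otimes>\<^sub>K \<real>\<close>, sending \<open>\<phi>\<close> to \<open>(1 + \<surd>5)/2\<close>.\<close>

definition K_real :: "qsqrt5 \<Rightarrow> real"
  where "K_real x = of_rat (rat_coeff x) + of_rat (root_coeff x) * sqrt 5"

lemma K_real_hom:
  "K_real 1 = 1" "K_real (x + y) = K_real x + K_real y" "K_real (x * y) = K_real x * K_real y"
  by (simp_all add: K_real_def one_qsqrt5_def plus_qsqrt5_def times_qsqrt5_def of_rat_add
      of_rat_mult algebra_simps)

lemma K_real_golden: "K_real \<phi> = (1 + sqrt 5) / 2"
  by (simp add: K_real_def golden_def of_rat_divide field_simps)


section \<open>Quaternions and octonions over a commutative ring\<close>

text \<open>\<open>Quat a b c d\<close> is \<open>a + b i + c j + d k\<close>.\<close>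

datatype 'a quat = Quat (q1: 'a) (qi: 'a) (qj: 'a) (qk: 'a)

instantiation quat :: (comm_ring_1) ring_1
begin

definition "0 = Quat 0 0 0 0"
definition "1 = Quat 1 0 0 0"
definition "x + y = Quat (q1 x + q1 y) (qi x + qi y) (qj x + qj y) (qk x + qk y)"
definition "- x = Quat (- q1 x) (- qi x) (- qj x) (- qk x)"
definition "x - y = Quat (q1 x - q1 y) (qi x - qi y) (qj x - qj y) (qk x - qk y)"
definition "x * y = Quat
  (q1 x * q1 y - qi x * qi y - qj x * qj y - qk x * qk y)
  (q1 x * qi y + qi x * q1 y + qj x * qk y - qk x * qj y)
  (q1 x * qj y - qi x * qk y + qj x * q1 y + qk x * qi y)
  (q1 x * qk y + qi x * qj y - qj x * qi y + qk x * q1 y)"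

instance
  by standard (auto simp: zero_quat_def one_quat_def plus_quat_def uminus_quat_def
      minus_quat_def times_quat_def algebra_simps intro!: quat.expand)

end

definition quat_cnj :: "'a::comm_ring_1 quat \<Rightarrow> 'a quat"
  where "quat_cnj x = Quat (q1 x) (- qi x) (- qj x) (- qk x)"

definition quat_scale :: "'a::comm_ring_1 \<Rightarrow> 'a quat \<Rightarrow> 'a quat"
  where "quat_scale c x = Quat (c * q1 x) (c * qi x) (c * qj x) (c * qk x)"

text \<open>\<open>Oct a b\<close> is \<open>a + b\<ell>\<close> in the Cayley--Dickson double.\<close>

datatype 'a octo = Oct (octo_fst: "'a quat") (octo_snd: "'a quat")

instantiation octo :: (comm_ring_1) "{ab_group_add, one, times}"
begin

definition "0 = Oct 0 0"
definition "1 = Oct 1 0"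
definition "x + y = Oct (octo_fst x + octo_fst y) (octo_snd x + octo_snd y)"
definition "- x = Oct (- octo_fst x) (- octo_snd x)"
definition "x - y = Oct (octo_fst x - octo_fst y) (octo_snd x - octo_snd y)"
definition "x * y = Oct
  (octo_fst x * octo_fst y - quat_cnj (octo_snd y) * octo_snd x)
  (octo_snd y * octo_fst x + octo_snd x * quat_cnj (octo_fst y))"

instance
  by standard (auto simp: zero_octo_def one_octo_def plus_octo_def uminus_octo_def
      minus_octo_def algebra_simps intro!: octo.expand)

end

definition octo_cnj :: "'a::comm_ring_1 octo \<Rightarrow> 'a octo"
  where "octo_cnj x = Oct (quat_cnj (octo_fst x)) (- octo_snd x)"

definition octo_scale :: "'a::comm_ring_1 \<Rightarrow> 'a octo \<Rightarrow> 'a octo"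
  where "octo_scale c x = Oct (quat_scale c (octo_fst x)) (quat_scale c (octo_snd x))"

definition octo_re :: "'a::comm_ring_1 octo \<Rightarrow> 'a"
  where "octo_re x = q1 (octo_fst x)"

text \<open>Subspaces and spans over both \<open>K\<close> and \<open>\<real>\<close> come from this interpretation.\<close>

global_interpretation octo: vector_space "octo_scale :: 'a::field \<Rightarrow> 'a octo \<Rightarrow> 'a octo"
  by standard (simp_all add: octo_scale_def quat_scale_def plus_octo_def plus_quat_def
      algebra_simps)

text \<open>The product \<open>x \<cdot> octo_cnj x\<close> is a scalar; \<open>octo_norm\<close> is that scalar
  as an element of the base ring.\<close>

definition octo_norm :: "'a::comm_ring_1 octo \<Rightarrow> 'a"
  where "octo_norm x = octo_re (x * octo_cnj x)"

lemma mult_octo_cnj: "x * octo_cnj x = octo_scale (octo_norm x) 1"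
  by (simp add: octo_norm_def octo_re_def octo_cnj_def octo_scale_def quat_scale_def quat_cnj_def
      times_octo_def one_octo_def times_quat_def minus_quat_def plus_quat_def uminus_quat_def
      zero_quat_def one_quat_def algebra_simps)

definition octo_polar :: "'a::comm_ring_1 octo \<Rightarrow> 'a octo \<Rightarrow> 'a"
  where "octo_polar x y = octo_norm (x + y) - octo_norm x - octo_norm y"

definition octo_inner :: "'a::comm_ring_1 octo \<Rightarrow> 'a octo \<Rightarrow> 'a"
  where "octo_inner x y = octo_re (x * octo_cnj y)"


section \<open>The icosian octonion lattice and its trace-polar dual\<close>

definition e1 :: "qsqrt5 quat" where "e1 = Quat 1 0 0 0"
definition e2 :: "qsqrt5 quat" where "e2 = Quat 0 1 0 0"
definition e3 :: "qsqrt5 quat" where "e3 = quat_scale (1/2) (Quat 1 1 1 1)"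
definition e4 :: "qsqrt5 quat" where "e4 = quat_scale (1/2) (Quat (- 1) (\<phi> - 1) (- \<phi>) 0)"

definition icosians :: "qsqrt5 quat set"
  where "icosians =
    {quat_scale a e1 + quat_scale b e2 + quat_scale c e3 + quat_scale d e4 | a b c d.
      a \<in> Z_phi \<and> b \<in> Z_phi \<and> c \<in> Z_phi \<and> d \<in> Z_phi}"

definition G0 :: "qsqrt5 octo set"
  where "G0 = {Oct a b | a b. a \<in> icosians \<and> b \<in> icosians}"

definition trace_dual :: "qsqrt5 octo set \<Rightarrow> qsqrt5 octo set"
  where "trace_dual L = {x. \<forall>g\<in>L. K_trace (octo_polar x g) \<in> \<int>}"

definition Z_phi_submodule :: "qsqrt5 octo set \<Rightarrow> bool"
  where "Z_phi_submodule M \<longleftrightarrow>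
    0 \<in> M \<and> (\<forall>x\<in>M. \<forall>y\<in>M. x + y \<in> M) \<and> (\<forall>c\<in>Z_phi. \<forall>x\<in>M. octo_scale c x \<in> M)"


section \<open>The discriminant quotient\<close>

definition dual_group :: "qsqrt5 octo monoid"
  where "dual_group = \<lparr>carrier = trace_dual G0, monoid.mult = (+), one = 0\<rparr>"

definition disc_group :: "qsqrt5 octo set monoid"
  where "disc_group = dual_group Mod G0"

definition disc_class :: "qsqrt5 octo \<Rightarrow> qsqrt5 octo set"
  where "disc_class x = G0 #>\<^bsub>dual_group\<^esub> x"

text \<open>The quotient as a vector space over \<open>\<F>\<^sub>5\<close> (\<open>residue_ring 5\<close>, with carrier \<open>{0..4}\<close>): a
  residue class \<open>a\<close> acts as the \<open>a\<close>-fold multiple. The ring multiplication and unit in the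
  library's module record are not used.\<close>

definition disc_space :: "(int, qsqrt5 octo set) module"
  where "disc_space =
    \<lparr>carrier = carrier disc_group, monoid.mult = undefined, one = undefined,
     zero = \<one>\<^bsub>disc_group\<^esub>, add = (\<otimes>\<^bsub>disc_group\<^esub>),
     smult = (\<lambda>a X. X [^]\<^bsub>disc_group\<^esub> a)\<rparr>"

definition F5_subspace :: "qsqrt5 octo set set \<Rightarrow> bool"
  where "F5_subspace C \<longleftrightarrow> submodule C (residue_ring 5) disc_space"

definition disc_preimage :: "qsqrt5 octo set set \<Rightarrow> qsqrt5 octo set"
  where "disc_preimage C = {x \<in> trace_dual G0. disc_class x \<in> C}"

definition trace_integral :: "qsqrt5 octo set set \<Rightarrow> bool"
  where "trace_integral C \<longleftrightarrow> (\<forall>x\<in>disc_preimage C. K_trace (octo_norm x) \<in> \<int>)"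

text \<open>Stability under the maps induced on classes, expressed on all representatives.\<close>

definition octonion_stable :: "qsqrt5 octo set set \<Rightarrow> bool"
  where "octonion_stable C \<longleftrightarrow>
    (\<forall>x\<in>disc_preimage C. disc_class (octo_cnj x) \<in> C \<and>
      (\<forall>g\<in>G0. disc_class (g * x) \<in> C \<and> disc_class (x * g) \<in> C))"


section \<open>Trace-integral golden octonion candidates\<close>

text \<open>\<open>\<O>(K) \<otimes>\<^sub>K \<real>\<close> is identified coordinatewise with \<open>real octo\<close>; for a \<open>K\<close>-subspace \<open>W\<close>
  of \<open>\<O>(K)\<close>, the subspace \<open>W \<otimes>\<^sub>K \<real>\<close> is then the real span of the image of \<open>W\<close>.\<close>

definition octo_real :: "qsqrt5 octo \<Rightarrow> real octo"
  where "octo_real = map_octo K_real"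

definition real_extension :: "qsqrt5 octo set \<Rightarrow> real octo set"
  where "real_extension W = octo.span (octo_real ` W)"

definition octo_reflection :: "real octo \<Rightarrow> real octo \<Rightarrow> real octo"
  where "octo_reflection \<alpha> v = v - octo_scale (2 * octo_inner v \<alpha> / octo_inner \<alpha> \<alpha>) \<alpha>"

definition orthogonal_splitting :: "real octo set \<Rightarrow> real octo set \<Rightarrow> bool"
  where "orthogonal_splitting V1 V2 \<longleftrightarrow>
    (\<forall>x\<in>V1. \<forall>y\<in>V2. octo_inner x y = 0) \<and> (\<forall>v. \<exists>x\<in>V1. \<exists>y\<in>V2. v = x + y)"

definition shell_indecomposable :: "qsqrt5 octo set \<Rightarrow> bool"
  where "shell_indecomposable S \<longleftrightarrow>
    \<not> (\<exists>W1 W2 V1 V2. octo.subspace W1 \<and> octo.subspace W2 \<and>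
        V1 = real_extension W1 \<and> V2 = real_extension W2 \<and>
        V1 \<noteq> {0} \<and> V2 \<noteq> {0} \<and> orthogonal_splitting V1 V2 \<and>
        octo_real ` S = (octo_real ` S \<inter> V1) \<union> (octo_real ` S \<inter> V2))"

text \<open>A shell is any finite set of elements with a common value of \<open>K_trace \<circ> octo_norm\<close>; it need
  not contain all elements of \<open>G\<close> with that value. If \<open>0 \<in> S\<close> then \<open>S = {0}\<close>, which is decomposable,
  so the reflection in the zero vector (here the identity) is immaterial.\<close>

definition norm_trace_shell :: "qsqrt5 octo set \<Rightarrow> qsqrt5 octo set \<Rightarrow> bool"
  where "norm_trace_shell G S \<longleftrightarrow>
    finite S \<and> S \<subseteq> G \<and> (\<exists>c. \<forall>x\<in>S. K_trace (octo_norm x) = c)"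

definition reflection_invariant :: "qsqrt5 octo set \<Rightarrow> bool"
  where "reflection_invariant S \<longleftrightarrow>
    (\<forall>\<alpha>\<in>S. octo_reflection (octo_real \<alpha>) ` octo_real ` S = octo_real ` S)"

definition G3B'_candidate :: "qsqrt5 octo set \<Rightarrow> bool"
  where "G3B'_candidate G \<longleftrightarrow>
    Z_phi_submodule G \<and>
    (\<forall>x\<in>G. K_trace (octo_norm x) \<in> \<int>) \<and>
    (\<forall>x\<in>G. \<forall>y\<in>G. K_trace (octo_polar x y) \<in> \<int>) \<and>
    (\<forall>x\<in>G. \<forall>y\<in>G. x * y \<in> G) \<and> (\<forall>x\<in>G. octo_cnj x \<in> G) \<and>
    (\<exists>S. norm_trace_shell G S \<and> reflection_invariant S \<and> shell_indecomposable S)"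

end

theory Submission
  imports Defs
begin

text \<open>The polar form \<open>B\<close> is unimodular over \<open>\<int>[\<phi>]\<close> on \<open>G0\<close>, so the trace-polar dual is
  \<open>(1/\<surd>5) G0\<close>, and an element \<open>x\<close> of it outside \<open>G0\<close> pairs with some \<open>g \<in> G0\<close> to a value
  \<open>u = B(x, g)\<close> in \<open>(1/\<surd>5)\<int>[\<phi>]\<close> but not in \<open>\<int>[\<phi>]\<close>. A submodule stable under conjugation and
  right multiplication by \<open>G0\<close> that contains \<open>x\<close> also contains the scalar
  \<open>x (octo_cnj g) + octo_cnj (x (octo_cnj g)) = u\<close>, whose norm \<open>u\<^sup>2\<close> has non-integral trace.\<close>

section \<open>Arithmetic of \<open>\<int>[\<phi>]\<close> and its inverse different\<close>

lemma of_nat_qsqrt5: "of_nat n = Q5 (of_nat n) 0"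
  by (induction n) (simp_all add: zero_qsqrt5_def one_qsqrt5_def plus_qsqrt5_def)

text \<open>Characteristic 0 lets the simplifier treat numerals as nonzero and clear the
  denominators in \<open>e3\<close> and \<open>e4\<close>.\<close>

instance qsqrt5 :: field_char_0
  by standard (simp add: inj_def of_nat_qsqrt5)

lemma of_int_qsqrt5: "of_int n = Q5 (of_int n) 0"
  by (cases n rule: int_diff_cases) (simp add: of_nat_qsqrt5 minus_qsqrt5_def)

lemma golden_square: "\<phi> * \<phi> = \<phi> + 1"
  by (simp add: golden_def times_qsqrt5_def plus_qsqrt5_def one_qsqrt5_def)

lemma golden_square_left: "\<phi> * (\<phi> * x) = \<phi> * x + x"
  by (simp add: mult.assoc[symmetric] golden_square distrib_right)

lemma golden_combination: "of_int a + of_int b * \<phi> = Q5 (of_int a + of_int b / 2) (of_int b / 2)"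
  by (simp add: of_int_qsqrt5 golden_def times_qsqrt5_def plus_qsqrt5_def)

text \<open>In \<open>Q5 r s\<close> the coefficient of \<phi> is \<open>2 * s\<close> and the
  constant term is \<open>r - s\<close>; the latter differs from \<open>r + s\<close> by
  \<open>2 * s\<close>.\<close>

lemma Z_phi_iff: "x \<in> Z_phi \<longleftrightarrow> rat_coeff x + root_coeff x \<in> \<int> \<and> 2 * root_coeff x \<in> \<int>"
proof
  assume "x \<in> Z_phi"
  then obtain a b where "x = of_int a + of_int b * \<phi>"
    by (auto simp: Z_phi_def)
  then have "x = Q5 (of_int a + of_int b / 2) (of_int b / 2)"
    by (simp only: golden_combination)
  then have "rat_coeff x + root_coeff x = of_int (a + b)" "2 * root_coeff x = of_int b"
    by simp_all
  then show "rat_coeff x + root_coeff x \<in> \<int> \<and> 2 * root_coeff x \<in> \<int>"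
    by (simp only: Ints_of_int)
next
  assume "rat_coeff x + root_coeff x \<in> \<int> \<and> 2 * root_coeff x \<in> \<int>"
  then obtain a b where ab: "rat_coeff x + root_coeff x = of_int a" "2 * root_coeff x = of_int b"
    by (auto elim!: Ints_cases)
  have "x = Q5 (of_int (a - b) + of_int b / 2) (of_int b / 2)"
    using ab by (cases x) simp
  then have "x = of_int (a - b) + of_int b * \<phi>"
    by (simp only: golden_combination)
  then show "x \<in> Z_phi"
    unfolding Z_phi_def by blast
qed

lemma Z_phi_golden: "\<phi> \<in> Z_phi"
  by (simp add: Z_phi_iff golden_def)

lemma Z_phi_add: "x \<in> Z_phi \<Longrightarrow> y \<in> Z_phi \<Longrightarrow> x + y \<in> Z_phi"
  using Ints_add[of "rat_coeff x + root_coeff x" "rat_coeff y + root_coeff y"]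
    Ints_add[of "2 * root_coeff x" "2 * root_coeff y"]
  by (auto simp: Z_phi_iff plus_qsqrt5_def algebra_simps)

lemma Z_phi_minus: "x \<in> Z_phi \<Longrightarrow> - x \<in> Z_phi"
  using Ints_minus[of "rat_coeff x + root_coeff x"] Ints_minus[of "2 * root_coeff x"]
  by (auto simp: Z_phi_iff uminus_qsqrt5_def algebra_simps)

lemma Z_phi_mult:
  assumes "x \<in> Z_phi" "y \<in> Z_phi"
  shows "x * y \<in> Z_phi"
proof -
  obtain a b c d where "x = of_int a + of_int b * \<phi>" "y = of_int c + of_int d * \<phi>"
    using assms by (auto simp: Z_phi_def)
  then have "x * y = of_int (a * c + b * d) + of_int (a * d + b * c + b * d) * \<phi>"
    by (simp add: algebra_simps golden_square golden_square_left)
  then show ?thesis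
    unfolding Z_phi_def by blast
qed

lemma Z_phi_0: "0 \<in> Z_phi" and Z_phi_1: "1 \<in> Z_phi"
  by (simp_all add: Z_phi_iff zero_qsqrt5_def one_qsqrt5_def)

lemma Z_phi_numeral: "numeral n \<in> Z_phi"
  by (simp add: Z_phi_iff of_nat_qsqrt5[of "numeral n", unfolded of_nat_numeral])

lemma Z_phi_diff: "x \<in> Z_phi \<Longrightarrow> y \<in> Z_phi \<Longrightarrow> x - y \<in> Z_phi"
  using Z_phi_add[OF _ Z_phi_minus] by fastforce

lemmas Z_phi_intros = Z_phi_0 Z_phi_1 Z_phi_numeral Z_phi_golden Z_phi_add Z_phi_minus Z_phi_diff
  Z_phi_mult

section \<open>The inverse different (1/\<surd>5)\<int>[\<phi>] and its quotient of order 5 by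
  \<int>[\<phi>]\<close>

definition inverse_different :: "qsqrt5 set"
  where "inverse_different = {t. \<forall>c\<in>Z_phi. K_trace (c * t) \<in> \<int>}"

lemma K_trace_eq: "K_trace x = 2 * rat_coeff x"
  by (cases x) (simp add: K_trace_Q5)

lemma K_trace_add: "K_trace (x + y) = K_trace x + K_trace y"
  by (simp add: K_trace_eq plus_qsqrt5_def)

lemma inverse_different_add:
  "s \<in> inverse_different \<Longrightarrow> t \<in> inverse_different \<Longrightarrow> s + t \<in> inverse_different"
  by (simp add: inverse_different_def distrib_left K_trace_add)

lemma inverse_different_mult:
  "c \<in> Z_phi \<Longrightarrow> t \<in> inverse_different \<Longrightarrow> c * t \<in> inverse_different"
  using Z_phi_mult by (auto simp: inverse_different_def mult.assoc[symmetric])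

text \<open>Since 1 and \<phi> span \<int>[\<phi>], two traces suffice: for
  \<open>t = Q5 r s\<close> they are Tr(t) = 2r and Tr(\<phi>t) = r + 5s.\<close>

lemma inverse_different_iff:
  "t \<in> inverse_different \<longleftrightarrow> 2 * rat_coeff t \<in> \<int> \<and> rat_coeff t + 5 * root_coeff t \<in> \<int>"
proof
  assume "t \<in> inverse_different"
  then have "K_trace (1 * t) \<in> \<int>" "K_trace (\<phi> * t) \<in> \<int>"
    using Z_phi_1 Z_phi_golden by (auto simp: inverse_different_def simp del: mult_1)
  then show "2 * rat_coeff t \<in> \<int> \<and> rat_coeff t + 5 * root_coeff t \<in> \<int>"
    by (simp add: K_trace_eq golden_def times_qsqrt5_def one_qsqrt5_def algebra_simps)
next
  assume *: "2 * rat_coeff t \<in> \<int> \<and> rat_coeff t + 5 * root_coeff t \<in> \<int>"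
  show "t \<in> inverse_different"
    unfolding inverse_different_def
  proof (intro CollectI ballI)
    fix c
    assume "c \<in> Z_phi"
    then obtain a b where "c = of_int a + of_int b * \<phi>"
      by (auto simp: Z_phi_def)
    then have "c = Q5 (of_int a + of_int b / 2) (of_int b / 2)"
      by (simp only: golden_combination)
    then have "K_trace (c * t)
        = of_int a * (2 * rat_coeff t) + of_int b * (rat_coeff t + 5 * root_coeff t)"
      by (simp add: K_trace_eq times_qsqrt5_def algebra_simps)
    then show "K_trace (c * t) \<in> \<int>"
      using * by simp
  qed
qed

lemma Z_phi_subset_inverse_different: "Z_phi \<subseteq> inverse_different"
proof
  fix x
  assume "x \<in> Z_phi"
  then obtain a b where "rat_coeff x + root_coeff x = of_int a" "2 * root_coeff x = of_int b"
    by (auto simp: Z_phi_iff elim!: Ints_cases)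
  then have "2 * rat_coeff x = of_int (2 * a - b)"
    "rat_coeff x + 5 * root_coeff x = of_int (a + 2 * b)"
    by simp_all
  then show "x \<in> inverse_different"
    unfolding inverse_different_iff by (simp only: Ints_of_int simp_thms)
qed

text \<open>The normal form is t = (1/\<surd>5)(q + p\<surd>5)/2; the parity condition says that (q
  + p\<surd>5)/2 lies in \<int>[\<phi>].\<close>

lemma inverse_different_cases:
  assumes "t \<in> inverse_different"
  obtains p q where "t = Q5 (of_int p / 2) (of_int q / 10)" "even (p + q)"
proof -
  obtain p r where pr: "2 * rat_coeff t = of_int p" "rat_coeff t + 5 * root_coeff t = of_int r"
    using assms by (auto simp: inverse_different_iff elim!: Ints_cases)
  then have "t = Q5 (of_int p / 2) (of_int (2 * r - p) / 10)"
    by (cases t) simp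
  then show ?thesis
    by (rule that) simp
qed

lemma Z_phi_iff_5_dvd:
  assumes "even (p + q)"
  shows "Q5 (of_int p / 2) (of_int q / 10) \<in> Z_phi \<longleftrightarrow> 5 dvd q"
proof
  assume "Q5 (of_int p / 2) (of_int q / 10) \<in> Z_phi"
  then obtain b where "of_int q / 5 = (of_int b :: rat)"
    by (auto simp: Z_phi_iff elim!: Ints_cases)
  then have "of_int q = (of_int (5 * b) :: rat)"
    by simp
  then show "5 dvd q"
    by (simp only: of_int_eq_iff) simp
next
  assume "5 dvd q"
  then obtain b where q: "q = 5 * b" ..
  \<comment> \<open>As 5 is odd, b has the parity of q, which is what (p + b\<surd>5)/2 needs to lie
    in \<int>[\<phi>].\<close>
  with assms have "even (p + b)"
    by simp
  then obtain a where "p + b = 2 * a" ..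
  then have "p = 2 * a - b"
    by simp
  then have "of_int p / 2 + of_int q / 10 = (of_int a :: rat)"
    by (simp add: q diff_divide_distrib)
  then show "Q5 (of_int p / 2) (of_int q / 10) \<in> Z_phi"
    by (simp add: Z_phi_iff q)
qed

text \<open>This is q mod 5 in the normal form of \<open>inverse_different_cases\<close>; on the
  inverse different the floor is taken of an integer.\<close>

definition different_residue :: "qsqrt5 \<Rightarrow> int"
  where "different_residue t = \<lfloor>10 * root_coeff t\<rfloor> mod 5"

lemma different_residue_Q5: "different_residue (Q5 a (of_int q / 10)) = q mod 5"
  by (simp add: different_residue_def)

lemma different_residue_add:
  assumes "s \<in> inverse_different" "t \<in> inverse_different"
  shows "different_residue (s + t) = (different_residue s + different_residue t) mod 5"
proof -
  obtain p q p' q' where st: "s = Q5 (of_int p / 2) (of_int q / 10)"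
      "t = Q5 (of_int p' / 2) (of_int q' / 10)"
    using assms by (metis inverse_different_cases)
  then have "s + t = Q5 (of_int p / 2 + of_int p' / 2) (of_int (q + q') / 10)"
    by (simp add: plus_qsqrt5_def add_divide_distrib)
  then show ?thesis
    unfolding st by (simp only: different_residue_Q5 mod_add_eq)
qed

lemma different_residue_eq_0_iff:
  assumes "t \<in> inverse_different"
  shows "different_residue t = 0 \<longleftrightarrow> t \<in> Z_phi"
  using assms
  by (metis inverse_different_cases Z_phi_iff_5_dvd different_residue_Q5 dvd_eq_mod_eq_0)

text \<open>Up to a scalar, \<open>Tr(u\<^sup>2)\<close> modulo \<open>\<int>\<close> is the anisotropic form \<open>x\<^sup>2\<close>
  on \<open>(1/\<surd>5)\<int>[\<phi>] / \<int>[\<phi>] \<simeq> \<F>\<^sub>5\<close>.\<close>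

lemma Z_phi_if_square_trace_integral:
  assumes "u \<in> inverse_different" "K_trace (u * u) \<in> \<int>"
  shows "u \<in> Z_phi"
proof -
  obtain p q where u: "u = Q5 (of_int p / 2) (of_int q / 10)" and even: "even (p + q)"
    using assms(1) by (rule inverse_different_cases)
  obtain n where "K_trace (u * u) = of_int n"
    using assms(2) by (auto elim!: Ints_cases)
  \<comment> \<open>Here Tr(u * u) = p^2/2 + q^2/10, so clearing denominators multiplies by
    10.\<close>
  then have "of_int (5 * p\<^sup>2 + q\<^sup>2) = (of_int (10 * n) :: rat)"
    by (simp add: u K_trace_eq times_qsqrt5_def power2_eq_square field_simps)
  then have "5 * p\<^sup>2 + q\<^sup>2 = 10 * n"
    by (simp only: of_int_eq_iff)
  then have "q\<^sup>2 = 5 * (2 * n - p\<^sup>2)"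
    by simp
  then have "5 dvd q\<^sup>2"
    by simp
  then have "5 dvd q"
    using prime_dvd_power[of "5::int" q 2] by simp
  then show ?thesis
    using even by (simp add: u Z_phi_iff_5_dvd)
qed


section \<open>Unimodularity of the icosian lattice\<close>

definition icosian_comb :: "qsqrt5 \<Rightarrow> qsqrt5 \<Rightarrow> qsqrt5 \<Rightarrow> qsqrt5 \<Rightarrow> qsqrt5 quat"
  where "icosian_comb a b c d =
    quat_scale a e1 + quat_scale b e2 + quat_scale c e3 + quat_scale d e4"

text \<open>Coordinates in the basis \<open>e1\<close>, \<open>e2\<close>, \<open>e3\<close>,
  \<open>e4\<close>, by back-substitution: only \<open>e3\<close> has a k-component, and only
  \<open>e3\<close> and \<open>e4\<close> have a j-component. The constants come from 1/\<phi> =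
  \<phi> - 1 and (\<phi> - 1)^2 = 2 - \<phi>.\<close>

definition icosian_coord :: "nat \<Rightarrow> qsqrt5 quat \<Rightarrow> qsqrt5"
  where "icosian_coord i w =
    [q1 w - qk w + (\<phi> - 1) * (qk w - qj w), qi w - qk w - (2 - \<phi>) * (qk w - qj w),
     2 * qk w, 2 * (\<phi> - 1) * (qk w - qj w)] ! i"

definition quat_polar :: "'a::comm_ring_1 quat \<Rightarrow> 'a quat \<Rightarrow> 'a"
  where "quat_polar x y = 2 * (q1 x * q1 y + qi x * qi y + qj x * qj y + qk x * qk y)"

lemmas icosian_basis_defs = e1_def e2_def e3_def e4_def quat_scale_def plus_quat_def

lemma all_less_4: "(\<forall>i<4. P i) \<longleftrightarrow> P 0 \<and> P 1 \<and> P 2 \<and> P (3::nat)"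
  by (simp add: numeral_eq_Suc All_less_Suc conj_ac)

lemma icosian_coord_add:
  "i < 4 \<Longrightarrow> icosian_coord i (v + w) = icosian_coord i v + icosian_coord i w"
proof -
  have "\<forall>i<4. icosian_coord i (v + w) = icosian_coord i v + icosian_coord i w"
    unfolding all_less_4
    by (simp add: icosian_coord_def plus_quat_def algebra_simps numeral_eq_Suc)
  then show "i < 4 \<Longrightarrow> icosian_coord i (v + w) = icosian_coord i v + icosian_coord i w"
    by blast
qed

lemma icosian_coord_scale:
  "i < 4 \<Longrightarrow> icosian_coord i (quat_scale c w) = c * icosian_coord i w"
proof -
  have "\<forall>i<4. icosian_coord i (quat_scale c w) = c * icosian_coord i w"
    unfolding all_less_4
    by (simp add: icosian_coord_def quat_scale_def algebra_simps numeral_eq_Suc)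
  then show "i < 4 \<Longrightarrow> icosian_coord i (quat_scale c w) = c * icosian_coord i w"
    by blast
qed

lemma icosian_coord_comb:
  "icosian_coord 0 (icosian_comb a b c d) = a"
  "icosian_coord 1 (icosian_comb a b c d) = b"
  "icosian_coord 2 (icosian_comb a b c d) = c"
  "icosian_coord 3 (icosian_comb a b c d) = d"
  by (simp_all add: icosian_coord_def icosian_comb_def icosian_basis_defs field_simps
      golden_square golden_square_left numeral_eq_Suc)

lemma icosian_comb_coord:
  "icosian_comb (icosian_coord 0 w) (icosian_coord 1 w) (icosian_coord 2 w) (icosian_coord 3 w) = w"
  by (cases w) (simp add: icosian_coord_def icosian_comb_def icosian_basis_defs field_simps
      golden_square golden_square_left numeral_eq_Suc)

lemma icosians_iff: "w \<in> icosians \<longleftrightarrow> (\<forall>i<4. icosian_coord i w \<in> Z_phi)"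
proof
  assume "w \<in> icosians"
  then obtain a b c d where "w = icosian_comb a b c d"
    "a \<in> Z_phi" "b \<in> Z_phi" "c \<in> Z_phi" "d \<in> Z_phi"
    by (auto simp: icosians_def icosian_comb_def)
  then show "\<forall>i<4. icosian_coord i w \<in> Z_phi"
    by (simp only: all_less_4 icosian_coord_comb simp_thms)
next
  assume "\<forall>i<4. icosian_coord i w \<in> Z_phi"
  then show "w \<in> icosians"
    unfolding icosians_def all_less_4 using icosian_comb_coord[of w]
    by (auto simp: icosian_comb_def) metis
qed

lemma icosian_basis_mem: "e1 \<in> icosians" "e2 \<in> icosians" "e3 \<in> icosians" "e4 \<in> icosians"
proof -
  have combs: "e1 = icosian_comb 1 0 0 0" "e2 = icosian_comb 0 1 0 0"
    "e3 = icosian_comb 0 0 1 0" "e4 = icosian_comb 0 0 0 1"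
    by (simp_all add: icosian_comb_def icosian_basis_defs)
  show "e1 \<in> icosians" "e2 \<in> icosians" "e3 \<in> icosians" "e4 \<in> icosians"
    unfolding icosians_iff all_less_4 combs icosian_coord_comb by (simp_all add: Z_phi_0 Z_phi_1)
qed

text \<open>The coefficients are the entries of the Gram matrix of the polar form.\<close>

lemma quat_polar_comb:
  "quat_polar w (icosian_comb a b c d) =
    a * (2 * icosian_coord 0 w + icosian_coord 2 w + (- 1) * icosian_coord 3 w) +
    (b * (2 * icosian_coord 1 w + icosian_coord 2 w + (\<phi> - 1) * icosian_coord 3 w) +
    (c * (icosian_coord 0 w + icosian_coord 1 w + 2 * icosian_coord 2 w
      + (- 1) * icosian_coord 3 w) +
    d * ((- 1) * icosian_coord 0 w + (\<phi> - 1) * icosian_coord 1 w + (- 1) * icosian_coord 2 w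
      + 2 * icosian_coord 3 w)))"
  by (simp add: icosian_coord_def icosian_comb_def icosian_basis_defs quat_polar_def field_simps
      golden_square golden_square_left numeral_eq_Suc)

text \<open>The coefficients are the entries of the inverse Gram matrix; it is integral because the
  Gram determinant is the unit \<open>\<phi>\<^sup>2\<close>.\<close>

lemma icosian_coord_eq_polar:
  "icosian_coord 0 w = (4 - 2 * \<phi>) * quat_polar w e1 + (5 - 3 * \<phi>) * quat_polar w e2
    + (\<phi> - 2) * quat_polar w e3 + (5 - 3 * \<phi>) * quat_polar w e4"
  "icosian_coord 1 w = (5 - 3 * \<phi>) * quat_polar w e1 + (8 - 4 * \<phi>) * quat_polar w e2
    + (\<phi> - 3) * quat_polar w e3 + (7 - 5 * \<phi>) * quat_polar w e4"
  "icosian_coord 2 w = (\<phi> - 2) * quat_polar w e1 + (\<phi> - 3) * quat_polar w e2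
    + 2 * quat_polar w e3 + (2 * \<phi> - 2) * quat_polar w e4"
  "icosian_coord 3 w = (5 - 3 * \<phi>) * quat_polar w e1 + (7 - 5 * \<phi>) * quat_polar w e2
    + (2 * \<phi> - 2) * quat_polar w e3 + (8 - 4 * \<phi>) * quat_polar w e4"
  by (simp_all add: icosian_coord_def icosian_basis_defs quat_polar_def field_simps
      golden_square golden_square_left numeral_eq_Suc)

text \<open>The Gram matrix and its inverse both have entries in \<int>[\<phi>], so polar values and
  coordinates are \<int>[\<phi>]-combinations of each other. The set \<open>A\<close> is left
  general to cover both \<open>Z_phi\<close> and \<open>inverse_different\<close>.\<close>

lemma icosian_unimodular:
  assumes add: "\<And>s t. s \<in> A \<Longrightarrow> t \<in> A \<Longrightarrow> s + t \<in> A"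
    and mult: "\<And>c t. c \<in> Z_phi \<Longrightarrow> t \<in> A \<Longrightarrow> c * t \<in> A"
  shows "(\<forall>g\<in>icosians. quat_polar w g \<in> A) \<longleftrightarrow> (\<forall>i<4. icosian_coord i w \<in> A)"
proof
  assume "\<forall>g\<in>icosians. quat_polar w g \<in> A"
  then have "quat_polar w e1 \<in> A" "quat_polar w e2 \<in> A" "quat_polar w e3 \<in> A" "quat_polar w e4 \<in> A"
    using icosian_basis_mem by blast+
  then show "\<forall>i<4. icosian_coord i w \<in> A"
    unfolding all_less_4 icosian_coord_eq_polar by (intro conjI add mult Z_phi_intros)
next
  assume coords: "\<forall>i<4. icosian_coord i w \<in> A"
  show "\<forall>g\<in>icosians. quat_polar w g \<in> A"
  proof
    fix g
    assume "g \<in> icosians"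
    then obtain a b c d where g: "g = icosian_comb a b c d"
      and abcd: "a \<in> Z_phi" "b \<in> Z_phi" "c \<in> Z_phi" "d \<in> Z_phi"
      by (auto simp: icosians_def icosian_comb_def)
    have "icosian_coord 0 w \<in> A" "icosian_coord 1 w \<in> A" "icosian_coord 2 w \<in> A"
        "icosian_coord 3 w \<in> A"
      using coords by (simp_all only: all_less_4)
    \<comment> \<open>The Gram expansion writes negative entries as factors in \<int>[\<phi>]
      instead of subtracting, so \<open>add\<close> and \<open>mult\<close> decompose it
      completely.\<close>
    with abcd show "quat_polar w g \<in> A"
      unfolding g quat_polar_comb by (intro add mult) (auto intro: Z_phi_intros)
  qed
qed

section \<open>Coordinates, duality and conjugation on \<open>G0\<close>\<close>

definition octo_coord :: "nat \<Rightarrow> qsqrt5 octo \<Rightarrow> qsqrt5"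
  where "octo_coord i x =
    (if i < 4 then icosian_coord i (octo_fst x) else icosian_coord (i - 4) (octo_snd x))"

lemma all_less_8: "(\<forall>i<8. P i) \<longleftrightarrow> (\<forall>i<4. P i) \<and> (\<forall>i<4. P (i + 4 :: nat))"
proof (intro iffI conjI allI impI; (elim conjE)?)
  fix i :: nat
  assume "\<forall>i<4. P i" "\<forall>i<4. P (i + 4)" "i < 8"
  then show "P i"
    using le_add_diff_inverse2[of 4 i] by (cases "i < 4") (auto dest: spec[of _ "i - 4"])
qed auto

lemma octo_coord_all_iff:
  "(\<forall>i<8. octo_coord i x \<in> A) \<longleftrightarrow>
    (\<forall>i<4. icosian_coord i (octo_fst x) \<in> A) \<and> (\<forall>i<4. icosian_coord i (octo_snd x) \<in> A)"
  by (simp add: all_less_8 octo_coord_def)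

lemma octo_coord_add: "i < 8 \<Longrightarrow> octo_coord i (x + y) = octo_coord i x + octo_coord i y"
  by (simp add: octo_coord_def plus_octo_def icosian_coord_add)

lemma octo_coord_scale: "i < 8 \<Longrightarrow> octo_coord i (octo_scale c x) = c * octo_coord i x"
  by (simp add: octo_coord_def octo_scale_def icosian_coord_scale)

lemma octo_coord_surj: "\<exists>x. \<forall>i<8. octo_coord i x = f i"
  by (rule exI[of _ "Oct (icosian_comb (f 0) (f 1) (f 2) (f 3))
      (icosian_comb (f 4) (f 5) (f 6) (f 7))"])
    (simp add: all_less_8 all_less_4 octo_coord_def icosian_coord_comb[unfolded One_nat_def])

lemma G0_iff: "x \<in> G0 \<longleftrightarrow> (\<forall>i<8. octo_coord i x \<in> Z_phi)"
  unfolding octo_coord_all_iff icosians_iff[symmetric] by (cases x) (simp add: G0_def)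

lemma octo_polar_eq:
  "octo_polar x y = quat_polar (octo_fst x) (octo_fst y) + quat_polar (octo_snd x) (octo_snd y)"
  by (simp add: octo_polar_def octo_norm_def octo_re_def octo_cnj_def quat_polar_def quat_cnj_def
      times_octo_def plus_octo_def times_quat_def plus_quat_def minus_quat_def uminus_quat_def
      algebra_simps)

lemma octo_polar_scale: "octo_polar x (octo_scale c y) = c * octo_polar x y"
  by (simp add: octo_polar_eq quat_polar_def octo_scale_def quat_scale_def algebra_simps)

lemma G0_unimodular:
  assumes add: "\<And>s t. s \<in> A \<Longrightarrow> t \<in> A \<Longrightarrow> s + t \<in> A"
    and mult: "\<And>c t. c \<in> Z_phi \<Longrightarrow> t \<in> A \<Longrightarrow> c * t \<in> A"
  shows "(\<forall>g\<in>G0. octo_polar x g \<in> A) \<longleftrightarrow> (\<forall>i<8. octo_coord i x \<in> A)"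
proof -
  have zero: "0 \<in> icosians" "quat_polar w 0 = 0" for w
    using icosian_coord_scale[of _ 0 0]
    by (simp_all add: icosians_iff quat_scale_def zero_quat_def quat_polar_def Z_phi_0)
  have "(\<forall>g\<in>G0. octo_polar x g \<in> A) \<longleftrightarrow>
    (\<forall>g\<in>icosians. quat_polar (octo_fst x) g \<in> A) \<and> (\<forall>g\<in>icosians. quat_polar (octo_snd x) g \<in> A)"
  proof
    assume *: "\<forall>g\<in>G0. octo_polar x g \<in> A"
    \<comment> \<open>The two summands are orthogonal, so test vectors supported in one of them
      isolate each component of \<open>x\<close>.\<close>
    have "octo_polar x (Oct g 0) \<in> A" "octo_polar x (Oct 0 g) \<in> A" if "g \<in> icosians" for g
      using * that zero(1) by (auto simp: G0_def)
    then show "(\<forall>g\<in>icosians. quat_polar (octo_fst x) g \<in> A) \<and>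
        (\<forall>g\<in>icosians. quat_polar (octo_snd x) g \<in> A)"
      by (auto simp: octo_polar_eq zero)
  qed (auto simp: G0_def octo_polar_eq intro: add)
  then show ?thesis
    by (simp add: octo_coord_all_iff icosian_unimodular[of A, OF add mult])
qed

lemma G0_scale: "c \<in> Z_phi \<Longrightarrow> x \<in> G0 \<Longrightarrow> octo_scale c x \<in> G0"
  by (simp add: G0_iff octo_coord_scale Z_phi_mult)

text \<open>\<open>G0\<close> is stable under \<int>[\<phi>], so integrality of Tr B(x, cg) = Tr(c
  B(x, g)) for all c in \<int>[\<phi>] places B(x, g) itself in the inverse different.\<close>

lemma trace_dual_G0_iff_polar: "x \<in> trace_dual G0 \<longleftrightarrow> (\<forall>g\<in>G0. octo_polar x g \<in> inverse_different)"
proof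
  assume x: "x \<in> trace_dual G0"
  show "\<forall>g\<in>G0. octo_polar x g \<in> inverse_different"
    unfolding inverse_different_def
  proof (intro ballI CollectI)
    fix g c
    assume "g \<in> G0" "c \<in> Z_phi"
    then show "K_trace (c * octo_polar x g) \<in> \<int>"
      using x G0_scale by (auto simp: trace_dual_def octo_polar_scale[symmetric])
  qed
next
  assume "\<forall>g\<in>G0. octo_polar x g \<in> inverse_different"
  then show "x \<in> trace_dual G0"
    using Z_phi_1 by (force simp: trace_dual_def inverse_different_def)
qed

lemma trace_dual_G0_iff: "x \<in> trace_dual G0 \<longleftrightarrow> (\<forall>i<8. octo_coord i x \<in> inverse_different)"
  unfolding trace_dual_G0_iff_polar
  by (rule G0_unimodular[OF inverse_different_add inverse_different_mult])

text \<open>Self-duality over \<int>[\<phi>]: membership in \<open>G0\<close> can be tested on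
  single values of B, which multiplication by \<open>G0\<close> turns into scalars.\<close>

lemma G0_iff_polar: "x \<in> G0 \<longleftrightarrow> (\<forall>g\<in>G0. octo_polar x g \<in> Z_phi)"
  by (simp add: G0_iff[of x] G0_unimodular[OF Z_phi_add Z_phi_mult])

lemma G0_cnj: "x \<in> G0 \<Longrightarrow> octo_cnj x \<in> G0"
proof -
  have cnj: "quat_cnj w \<in> icosians" "- w \<in> icosians" if "w \<in> icosians" for w
  proof -
    \<comment> \<open>The conjugates of \<open>e3\<close> and \<open>e4\<close> are
      \<open>e1 - e3\<close> and \<open>- e1 - e4\<close>, whence the first coefficient
      \<open>a + c - d\<close>.\<close>
    have "quat_cnj (icosian_comb a b c d) = icosian_comb (a + c - d) (- b) (- c) (- d)"
        "- icosian_comb a b c d = icosian_comb (- a) (- b) (- c) (- d)" for a b c d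
      by (simp_all add: icosian_comb_def icosian_basis_defs quat_cnj_def uminus_quat_def
          field_simps)
    moreover obtain a b c d where "w = icosian_comb a b c d"
      "a \<in> Z_phi" "b \<in> Z_phi" "c \<in> Z_phi" "d \<in> Z_phi"
      using \<open>w \<in> icosians\<close> by (auto simp: icosians_def icosian_comb_def)
    ultimately show "quat_cnj w \<in> icosians" "- w \<in> icosians"
      unfolding icosians_iff all_less_4
      by (simp_all only: icosian_coord_comb) (auto intro: Z_phi_intros)
  qed
  assume "x \<in> G0"
  then show "octo_cnj x \<in> G0"
    by (auto simp: G0_def octo_cnj_def cnj)
qed


section \<open>Multiplicatively stable trace-integral overlattices\<close>

text \<open>An octonion plus its conjugate is twice its real part, and twice the real part of xg is
  the polar form of x with the conjugate of g.\<close>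

lemma mult_add_cnj_mult: "x * g + octo_cnj (x * g) = octo_scale (octo_polar x (octo_cnj g)) 1"
  by (simp add: octo_polar_eq quat_polar_def octo_cnj_def quat_cnj_def octo_scale_def
      quat_scale_def one_octo_def one_quat_def zero_quat_def times_octo_def plus_octo_def
      times_quat_def plus_quat_def minus_quat_def uminus_quat_def algebra_simps)

lemma octo_norm_scalar: "octo_norm (octo_scale c 1) = c * c"
  by (simp add: octo_norm_def octo_re_def octo_cnj_def quat_cnj_def octo_scale_def
      quat_scale_def one_octo_def one_quat_def zero_quat_def times_octo_def
      times_quat_def minus_quat_def uminus_quat_def)

text \<open>The hypotheses are closure properties shared by preimages of stable subspaces and by
  candidate modules, so one argument settles both.\<close>

lemma trace_integral_subset_G0:
  assumes "M \<subseteq> trace_dual G0"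
    and add: "\<And>x y. x \<in> M \<Longrightarrow> y \<in> M \<Longrightarrow> x + y \<in> M"
    and cnj: "\<And>x. x \<in> M \<Longrightarrow> octo_cnj x \<in> M"
    and mult: "\<And>x g. x \<in> M \<Longrightarrow> g \<in> G0 \<Longrightarrow> x * g \<in> M"
    and integral: "\<And>x. x \<in> M \<Longrightarrow> K_trace (octo_norm x) \<in> \<int>"
  shows "M \<subseteq> G0"
proof
  fix x
  assume x: "x \<in> M"
  show "x \<in> G0"
    unfolding G0_iff_polar
  proof
    fix g
    assume g: "g \<in> G0"
    \<comment> \<open>Multiplying by the conjugate of \<open>g\<close> makes the resulting scalar
      B(x, g) itself.\<close>
    have "x * octo_cnj g + octo_cnj (x * octo_cnj g) \<in> M"
      using x g by (intro add cnj mult G0_cnj)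
    moreover have "octo_cnj (octo_cnj g) = g"
      by (simp add: octo_cnj_def quat_cnj_def)
    ultimately have "octo_scale (octo_polar x g) 1 \<in> M"
      by (simp add: mult_add_cnj_mult)
    then have "K_trace (octo_polar x g * octo_polar x g) \<in> \<int>"
      using integral[of "octo_scale (octo_polar x g) 1"] by (simp add: octo_norm_scalar)
    moreover have "octo_polar x g \<in> inverse_different"
      using assms(1) x g by (auto simp: trace_dual_G0_iff_polar)
    ultimately show "octo_polar x g \<in> Z_phi"
      by (rule Z_phi_if_square_trace_integral[rotated])
  qed
qed


section \<open>The discriminant group\<close>

lemma dual_group_simps [simp]:
  "carrier dual_group = trace_dual G0" "x \<otimes>\<^bsub>dual_group\<^esub> y = x + y" "\<one>\<^bsub>dual_group\<^esub> = 0"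
  by (simp_all add: dual_group_def)

lemma trace_dual_G0_add: "x \<in> trace_dual G0 \<Longrightarrow> y \<in> trace_dual G0 \<Longrightarrow> x + y \<in> trace_dual G0"
  by (simp add: trace_dual_G0_iff octo_coord_add inverse_different_add)

lemma trace_dual_G0_scale: "c \<in> Z_phi \<Longrightarrow> x \<in> trace_dual G0 \<Longrightarrow> octo_scale c x \<in> trace_dual G0"
  by (simp add: trace_dual_G0_iff octo_coord_scale inverse_different_mult)

lemma G0_zero: "0 \<in> G0"
  using octo_coord_scale[of _ 0 0] by (simp add: G0_iff Z_phi_0)

lemma G0_subset_trace_dual: "G0 \<subseteq> trace_dual G0"
  unfolding subset_iff G0_iff trace_dual_G0_iff using Z_phi_subset_inverse_different by blast

lemma group_dual_group: "group dual_group"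
proof (rule groupI)
  fix x
  assume "x \<in> carrier dual_group"
  then have "- x \<in> carrier dual_group"
    using trace_dual_G0_scale[of "- 1" x] by (simp add: Z_phi_intros)
  then show "\<exists>y\<in>carrier dual_group. y \<otimes>\<^bsub>dual_group\<^esub> x = \<one>\<^bsub>dual_group\<^esub>"
    by (auto intro: bexI[of _ "- x"])
qed (use G0_zero G0_subset_trace_dual in \<open>auto simp: trace_dual_G0_add add.assoc\<close>)

text \<open>This map induces the isomorphism of the quotient with \<F>\<open>\<^sub>5\<close>^8. The
  restriction to \<open>{..<8}\<close> is there because elements of \<open>product_group\<close> are
  extensional functions.\<close>

definition disc_residues :: "qsqrt5 octo \<Rightarrow> nat \<Rightarrow> int"
  where "disc_residues x = (\<lambda>i\<in>{..<8}. different_residue (octo_coord i x))"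

abbreviation (input) F5_power_8 :: "(nat \<Rightarrow> int) monoid"
  where "F5_power_8 \<equiv> product_group {..<8::nat} (\<lambda>_. integer_mod_group 5)"

lemma disc_residues_hom: "group_hom dual_group F5_power_8 disc_residues"
proof -
  have "disc_residues \<in> hom dual_group F5_power_8"
  proof (rule homI)
    fix x
    show "disc_residues x \<in> carrier F5_power_8"
      by (simp add: disc_residues_def carrier_integer_mod_group different_residue_def)
  next
    fix x y
    assume "x \<in> carrier dual_group" "y \<in> carrier dual_group"
    then show "disc_residues (x \<otimes>\<^bsub>dual_group\<^esub> y) = disc_residues x \<otimes>\<^bsub>F5_power_8\<^esub> disc_residues y"
      by (auto simp: disc_residues_def trace_dual_G0_iff octo_coord_add different_residue_add
          intro!: restrict_ext)
  qed
  then show ?thesis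
    using group_dual_group by (simp add: group_hom_def group_hom_axioms_def)
qed

text \<open>On the dual, a coordinate has residue 0 exactly when it lies in \<int>[\<phi>].\<close>

lemma disc_residues_kernel: "kernel dual_group F5_power_8 disc_residues = G0"
proof -
  have "disc_residues x = \<one>\<^bsub>F5_power_8\<^esub> \<longleftrightarrow> x \<in> G0" if "x \<in> trace_dual G0" for x
  proof -
    have "disc_residues x = \<one>\<^bsub>F5_power_8\<^esub> \<longleftrightarrow> (\<forall>i<8. different_residue (octo_coord i x) = 0)"
      by (auto simp: disc_residues_def fun_eq_iff)
    also have "\<dots> \<longleftrightarrow> x \<in> G0"
      using that by (auto simp: G0_iff trace_dual_G0_iff different_residue_eq_0_iff)
    finally show ?thesis .
  qed
  then show ?thesis
    using G0_subset_trace_dual by (auto simp: kernel_def)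
qed

lemma disc_residues_image: "disc_residues ` carrier dual_group = carrier F5_power_8"
proof
  show "disc_residues ` carrier dual_group \<subseteq> carrier F5_power_8"
    using group_hom.hom_closed[OF disc_residues_hom] by blast
next
  show "carrier F5_power_8 \<subseteq> disc_residues ` carrier dual_group"
  proof
    fix m
    assume m: "m \<in> carrier F5_power_8"
    text \<open>Division by \<open>\<surd>5\<close> doubles: \<open>different_residue (n/\<surd>5) = 2n mod 5\<close>, and \<open>3\<close> inverts \<open>2\<close>.\<close>
    obtain x where x: "\<forall>i<8. octo_coord i x = Q5 0 (of_int (6 * m i) / 10)"
      using octo_coord_surj[of "\<lambda>i. Q5 0 (of_int (6 * m i) / 10)"] by blast
    have "Q5 0 (of_int (6 * n) / 10) \<in> inverse_different" for n
    proof -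
      have "5 * (of_int (6 * n) / 10) = (of_int (3 * n) :: rat)"
        by simp
      then show ?thesis
        unfolding inverse_different_iff qsqrt5.sel by (simp only: Ints_of_int add_0) simp
    qed
    with x have "x \<in> trace_dual G0"
      by (simp only: trace_dual_G0_iff) simp
    moreover have "6 * m i mod 5 = m i" if "i < 8" for i
    proof -
      have "m i \<in> {0..<5}"
        using m that by (auto simp: carrier_integer_mod_group PiE_iff)
      then show ?thesis
        by (simp only: atLeastLessThan_iff) presburger
    qed
    then have "disc_residues x = m"
      using m x by (auto simp: fun_eq_iff disc_residues_def different_residue_Q5 PiE_iff
          extensional_def simp del: of_int_mult)
    ultimately show "m \<in> disc_residues ` carrier dual_group"
      by auto
  qed
qed

text \<open>First isomorphism theorem for the surjective map \<open>disc_residues\<close>.\<close>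

lemma disc_group_iso: "disc_group \<cong> F5_power_8"
  using group_hom.FactGroup_iso[OF disc_residues_hom disc_residues_image]
  by (simp only: disc_residues_kernel disc_group_def)

lemma normal_G0: "G0 \<lhd> dual_group"
  using group_hom.normal_kernel[OF disc_residues_hom] by (simp only: disc_residues_kernel)

section \<open>From subspaces of the quotient to their preimages\<close>

lemma disc_class_eq: "disc_class x = (\<lambda>g. g + x) ` G0"
  by (auto simp: disc_class_def r_coset_def)

text \<open>The preimage of \<open>C\<close> satisfies the hypotheses of
  \<open>trace_integral_subset_G0\<close>, so every class in \<open>C\<close> has a representative
  in \<open>G0\<close> and is the zero class.\<close>

lemma F5_subspace_trivial:
  assumes C: "F5_subspace C" "trace_integral C" "octonion_stable C"
  shows "C = {\<zero>\<^bsub>disc_space\<^esub>}"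
proof -
  interpret submodule C "residue_ring 5" disc_space
    using C(1) by (simp add: F5_subspace_def)
  interpret G0: normal G0 dual_group
    by (rule normal_G0)
  have zero: "\<zero>\<^bsub>disc_space\<^esub> = G0"
    by (simp add: disc_space_def disc_group_def FactGroup_def)
  have C_class: "\<exists>x\<in>trace_dual G0. X = disc_class x" if "X \<in> C" for X
    using subset that
    by (auto simp: disc_space_def disc_group_def FactGroup_def RCOSETS_def disc_class_def)
  \<comment> \<open>Stability only asserts that the class of a product or conjugate lies in
    \<open>C\<close>. That the element itself lies in the dual follows because it belongs to its own
    coset, which is the coset of some dual element.\<close>
  have preimageI: "x \<in> disc_preimage C" if x: "disc_class x \<in> C" for x
  proof -
    obtain y where y: "y \<in> trace_dual G0" "disc_class x = disc_class y"
      using C_class[OF x] by blast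
    have "x \<in> disc_class x"
      using G0_zero by (force simp: disc_class_eq)
    then have "x \<in> trace_dual G0"
      using y G0_subset_trace_dual by (auto simp: disc_class_eq intro: trace_dual_G0_add)
    with x show ?thesis
      by (simp add: disc_preimage_def)
  qed
  have class_add: "disc_class (x + y) \<in> C" if "x \<in> disc_preimage C" "y \<in> disc_preimage C" for x y
  proof -
    have "disc_class (x + y) = disc_class x \<otimes>\<^bsub>disc_group\<^esub> disc_class y"
      using that G0.rcos_sum[of x y]
      by (simp add: disc_preimage_def disc_class_def disc_group_def FactGroup_def)
    moreover have "disc_class x \<otimes>\<^bsub>disc_group\<^esub> disc_class y \<in> C"
      using that m_closed[of "disc_class x" "disc_class y"]
      by (simp add: disc_preimage_def disc_space_def)
    ultimately show ?thesis
      by simp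
  qed
  have "disc_preimage C \<subseteq> G0"
  proof (rule trace_integral_subset_G0)
    show "disc_preimage C \<subseteq> trace_dual G0"
      by (auto simp: disc_preimage_def)
  qed (use C(2,3) in \<open>auto simp: trace_integral_def octonion_stable_def intro: preimageI class_add\<close>)
  moreover have "disc_class x = G0" if "x \<in> G0" for x
    using that G0.rcos_const by (simp add: disc_class_def)
  ultimately have "X = G0" if "X \<in> C" for X
    using C_class[OF that] that by (auto simp: disc_preimage_def)
  \<comment> \<open>A subspace contains zero; this excludes the empty set and gives
    equality.\<close>
  moreover have "G0 \<in> C"
    using one_closed zero by simp
  ultimately show ?thesis
    unfolding zero by blast
qed

theorem proposition6p19:
  shows "disc_group \<cong> product_group {..<8::nat} (\<lambda>_. integer_mod_group 5)
    \<and> \<not> (\<exists>C. F5_subspace C \<and> C \<noteq> {\<zero>\<^bsub>disc_space\<^esub>} \<and> trace_integral C \<and> octonion_stable C)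
    \<and> \<not> (\<exists>G. Z_phi_submodule G \<and> G0 \<subset> G \<and> G \<subseteq> trace_dual G0 \<and> G3B'_candidate G)"
proof (intro conjI notI)
  show "disc_group \<cong> product_group {..<8::nat} (\<lambda>_. integer_mod_group 5)"
    by (rule disc_group_iso)
next
  assume "\<exists>C. F5_subspace C \<and> C \<noteq> {\<zero>\<^bsub>disc_space\<^esub>} \<and> trace_integral C \<and> octonion_stable C"
  then show False
    using F5_subspace_trivial by blast
next
  assume "\<exists>G. Z_phi_submodule G \<and> G0 \<subset> G \<and> G \<subseteq> trace_dual G0 \<and> G3B'_candidate G"
  then obtain G where G: "Z_phi_submodule G" "G0 \<subset> G" "G \<subseteq> trace_dual G0" "G3B'_candidate G"
    by blast
  \<comment> \<open>Since \<open>G\<close> contains \<open>G0\<close>, closure under its own product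
    includes right multiplication by \<open>G0\<close>.\<close>
  then have "G \<subseteq> G0"
    by (intro trace_integral_subset_G0) (auto simp: G3B'_candidate_def Z_phi_submodule_def)
  with G(2) show False
    by blast
qed

end
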